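(* Let $f_{\mathrm{cl}}:\mathbb{R}^{n}\to\mathbb{R}^{n}$ be continuous with equilibrium $\xi^*$ (i.e. $f_{\mathrm{cl}}(\xi^* )=\xi^*$). Let $V:\mathbb{R}^{n}\to\mathbb{R}$ be a Lyapunov candidate of one of the two forms given in the context, let $\kappa>0$, $c_0>0$, $\rho\in\mathbb{R}$, let $\mathcal{B}=\{\xi\in\mathbb{R}^{n} : \xi_{\mathrm{lo}}\le\xi\le\xi_{\mathrm{up}}\}$ (componentwise inequalities) be an axis-aligned box containing $\xi^*$, and put $\mathcal{S}:=\{\xi\in\mathcal{B} : V(\xi)<\rho\}$. Define $$F(\xi):=V(f_{\mathrm{cl}}(\xi))-(1-\kappa)V(\xi),\qquad H(\zeta):=\|\mathrm{ReLU}(\zeta-\xi_{\mathrm{up}})\|_1+\|\mathrm{ReLU}(\xi_{\mathrm{lo}}-\zeta)\|_1 .$$ Then the following two conditions are equivalent: (a) for all $\xi\in\mathcal{S}$: $F(\xi)\le 0$ and $H(f_{\mathrm{cl}}(\xi))\le 0$; (b) for all $\xi\in\mathcal{B}$: $\min\bigl(\mathrm{ReLU}(F(\xi))+c_0\,H(f_{\mathrm{cl}}(\xi)),\ \rho-V(\xi)\bigr)\le 0$.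
   Context: $\mathrm{ReLU}(s)=\max(s,0)$, applied componentwise to vectors, and $\|\cdot\|_1$ is the $\ell_1$ norm. The map $f_{\mathrm{cl}}$ is the closed-loop dynamics $\xi_{t+1}=f_{\mathrm{cl}}(\xi_t)$. Lyapunov candidates. Fix $\epsilon>0$ and a matrix $R\in\mathbb{R}^{n\times n}$. The function $V$ is either (1) $V(\xi)=|\phi_V(\xi)-\phi_V(\xi^* )|+\|(\epsilon I+R^{T}R)(\xi-\xi^* )\|_1$, where $\phi_V:\mathbb{R}^{n}\to\mathbb{R}$ is a neural network (a continuous function), or (2) $V(\xi)=(\xi-\xi^* )^{T}(\epsilon I+R^{T}R)(\xi-\xi^* )$. *)

theory Defs
  imports "HOL-Analysis.Analysis"
begin

definition relu :: "real \<Rightarrow> real" where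
  "relu s = max s 0"

definition relu_vec :: "real ^ 'n \<Rightarrow> real ^ 'n" where
  "relu_vec x = (\<chi> i. relu (x $ i))"

definition norm_l1 :: "real ^ 'n \<Rightarrow> real" where
  "norm_l1 x = (\<Sum>i\<in>UNIV. \<bar>x $ i\<bar>)"

definition lyap_matrix :: "real \<Rightarrow> real ^ 'n ^ 'n \<Rightarrow> real ^ 'n ^ 'n" where
  "lyap_matrix \<epsilon> R = \<epsilon> *\<^sub>R mat 1 + transpose R ** R"

definition V_network ::
  "(real ^ 'n \<Rightarrow> real) \<Rightarrow> real \<Rightarrow> real ^ 'n ^ 'n \<Rightarrow> real ^ 'n \<Rightarrow> real ^ 'n \<Rightarrow> real" where
  "V_network \<phi> \<epsilon> R \<xi>s \<xi> =
     \<bar>\<phi> \<xi> - \<phi> \<xi>s\<bar> + norm_l1 (lyap_matrix \<epsilon> R *v (\<xi> - \<xi>s))"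

definition V_quadratic ::
  "real \<Rightarrow> real ^ 'n ^ 'n \<Rightarrow> real ^ 'n \<Rightarrow> real ^ 'n \<Rightarrow> real" where
  "V_quadratic \<epsilon> R \<xi>s \<xi> = (\<xi> - \<xi>s) \<bullet> (lyap_matrix \<epsilon> R *v (\<xi> - \<xi>s))"

text \<open>The network in the first form enters only as a continuous function; no architecture is
  imposed on it.\<close>

definition lyapunov_candidate ::
  "real \<Rightarrow> real ^ 'n ^ 'n \<Rightarrow> real ^ 'n \<Rightarrow> (real ^ 'n \<Rightarrow> real) \<Rightarrow> bool" where
  "lyapunov_candidate \<epsilon> R \<xi>s V \<longleftrightarrow>
     (\<exists>\<phi>. continuous_on UNIV \<phi> \<and> V = V_network \<phi> \<epsilon> R \<xi>s) \<or> V = V_quadratic \<epsilon> R \<xi>s"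

text \<open>The order on \<^typ>\<open>real ^ 'n\<close> is componentwise, so the interval is the axis-aligned box.\<close>

definition sublevel_box ::
  "(real ^ 'n \<Rightarrow> real) \<Rightarrow> real \<Rightarrow> real ^ 'n \<Rightarrow> real ^ 'n \<Rightarrow> (real ^ 'n) set" where
  "sublevel_box V \<rho> lo up = {\<xi> \<in> {lo..up}. V \<xi> < \<rho>}"

definition decrease_violation ::
  "(real ^ 'n \<Rightarrow> real) \<Rightarrow> (real ^ 'n \<Rightarrow> real ^ 'n) \<Rightarrow> real \<Rightarrow> real ^ 'n \<Rightarrow> real" where
  "decrease_violation V f \<kappa> \<xi> = V (f \<xi>) - (1 - \<kappa>) * V \<xi>"

definition box_violation :: "real ^ 'n \<Rightarrow> real ^ 'n \<Rightarrow> real ^ 'n \<Rightarrow> real" where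
  "box_violation lo up \<zeta> = norm_l1 (relu_vec (\<zeta> - up)) + norm_l1 (relu_vec (lo - \<zeta>))"

end

theory Submission
  imports Defs
begin

text \<open>The equivalence holds pointwise on the box. A minimum is nonpositive iff one of its
  arguments is, and for a box point \<open>\<rho> - V \<xi> \<le> 0\<close> means lying outside the
  sublevel set. So the second condition asks for a nonpositive penalty at each point of that set,
  and by \<open>relu_plus_scaled_nonpos_iff\<close> this means that neither violation is
  positive.\<close>

lemma box_violation_nonneg: "0 \<le> box_violation lo up \<zeta>"
  unfolding box_violation_def norm_l1_def by (intro add_nonneg_nonneg sum_nonneg abs_ge_zero)

text \<open>Two nonnegative terms cannot cancel, so a nonpositive sum forces both to vanish;
  \<open>c > 0\<close> lets the bound pass from \<open>c * h\<close> to \<open>h\<close>.\<close>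

lemma relu_plus_scaled_nonpos_iff:
  assumes "c > 0" and "h \<ge> 0"
  shows "relu s + c * h \<le> 0 \<longleftrightarrow> s \<le> 0 \<and> h \<le> 0"
proof
  assume *: "relu s + c * h \<le> 0"
  have "0 \<le> relu s" "s \<le> relu s" by (auto simp: relu_def)
  moreover have "0 \<le> c * h" using assms by simp
  ultimately have "s \<le> 0" and "c * h \<le> 0" using * by linarith+
  then show "s \<le> 0 \<and> h \<le> 0" using assms by (simp add: mult_le_0_iff)
next
  assume "s \<le> 0 \<and> h \<le> 0"
  then show "relu s + c * h \<le> 0" using assms by (simp add: relu_def)
qed

theorem theorem3p4:
  fixes f :: "real ^ 'n \<Rightarrow> real ^ 'n"
    and \<xi>s lo up :: "real ^ 'n"
    and R :: "real ^ 'n ^ 'n"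
    and V :: "real ^ 'n \<Rightarrow> real"
    and \<epsilon> \<kappa> c0 \<rho> :: real
  assumes "continuous_on UNIV f"
    and "f \<xi>s = \<xi>s"
    and "\<epsilon> > 0"
    and "lyapunov_candidate \<epsilon> R \<xi>s V"
    and "\<kappa> > 0"
    and "c0 > 0"
    and "\<xi>s \<in> {lo..up}"
  shows "(\<forall>\<xi> \<in> sublevel_box V \<rho> lo up.
            decrease_violation V f \<kappa> \<xi> \<le> 0 \<and> box_violation lo up (f \<xi>) \<le> 0)
     \<longleftrightarrow>
         (\<forall>\<xi> \<in> {lo..up}.
            min (relu (decrease_violation V f \<kappa> \<xi>) + c0 * box_violation lo up (f \<xi>))
                (\<rho> - V \<xi>) \<le> 0)"
  unfolding sublevel_box_def min_le_iff_disj diff_le_0_iff_le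
    relu_plus_scaled_nonpos_iff[OF \<open>c0 > 0\<close> box_violation_nonneg]
  \<comment> \<open>With box membership kept opaque and \<open>\<rho> \<le> V \<xi>\<close> read as
    the negation of \<open>V \<xi> < \<rho>\<close>, only trading a disjunction for an implication
    remains.\<close>
  by (auto simp del: atLeastAtMost_iff simp: not_less[symmetric])

end
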